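(* Let $\Theta=(\Gamma,(x_{k,i}))$ be a patch framework with $\Gamma$ connected and with every view affinely non-degenerate. Let $S$ be a perfect alignment. Then $\Theta(S)$ is globally rigid if and only if $S$ is unique.
   Context: Patch framework. $\Gamma$ is a bipartite graph on $n+m$ vertices; vertex $k\in\{1,\dots,n\}$ represents the $k$th point and vertex $n+i$, $i\in\{1,\dots,m\}$, the $i$th view; $(k,i)\in E(\Gamma)$ means that point $k$ is in view $i$, with local coordinates $x_{k,i}\in\mathbb{R}^d$. The tuple $\Theta=(\Gamma,(x_{k,i}))$ is a patch framework. A view $i$ is affinely non-degenerate if it has at least $d+1$ points and the affine span of $\{x_{k,i}:(k,i)\in E(\Gamma)\}$ has dimension $d$. Put $e_{ki}=e_k-e_{n+i}\in\mathbb{R}^{n+m}$, $\varepsilon_i$ the $i$th standard basis vector of $\mathbb{R}^m$, $\mathcal{L}_\Gamma=\sum_{(k,i)\in E(\Gamma)}e_{ki}e_{ki}^T$, $B=\sum_{(k,i)\in E(\Gamma)}(\varepsilon_i\otimes I_d)x_{k,i}e_{ki}^T$, $D=\sum_{(k,i)\in E(\Gamma)}(\varepsilon_i\otimes I_d)x_{k,i}x_{k,i}^T(\varepsilon_i\otimes I_d)^T$, and $C=D-B\mathcal{L}_\Gamma^\dagger B^T\in\mathbb{R}^{md\times md}$ (positive semi-definite), where $\dagger$ is the Moore–Penrose pseudoinverse. An alignment is an element $S=[S_i]_1^m$ (vertical stack) of $\mathbb{O}(d)^m\subseteq\mathbb{R}^{md\times d}$; $F(S)=\mathrm{Tr}(CSS^T)$;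 $S$ is perfect if $F(S)=0$ (hence optimal, i.e. a global minimizer of $F$). An optimal alignment $S$ is unique if every other optimal alignment $O\in\mathbb{O}(d)^m$ is of the form $O=SQ$ for some $Q\in\mathbb{O}(d)$. Realization. For an alignment $S$, $\Theta(S)=S^TB\,\mathcal{L}_\Gamma^\dagger(:,1{:}n)\,(I_n-n^{-1}\mathbf{1}_n\mathbf{1}_n^T)\in\mathbb{R}^{d\times n}$, where $(:,1{:}n)$ denotes the first $n$ columns and $\mathbf{1}_n$ the all-ones vector. For a perfect alignment $S$, $\Theta(S)$ is globally rigid if for every perfect alignment $O\in\mathbb{O}(d)^m$ there is $Q\in\mathbb{O}(d)$ with $\Theta(O)=\Theta(SQ)$. *)

theory Defs
  imports "HOL-Analysis.Analysis"
begin

text \<open>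
  The finite types \<open>'n\<close>, \<open>'m\<close>, \<open>'d\<close> index the points, the views and the coordinates of
  \<open>\<real>\<^sup>d\<close>. Vertices of the graph are elements of \<open>'n + 'm\<close>, with \<open>Inl k\<close> the point \<open>k\<close> and \<open>Inr i\<close>
  the view \<open>i\<close>, and the \<open>md\<close> rows of a stacked matrix are indexed by \<open>'m \<times> 'd\<close>, so that row
  \<open>(i, a)\<close> is row \<open>a\<close> of the \<open>i\<close>-th \<open>d \<times> d\<close> block. A patch framework is given by
  its edge set \<open>E\<close> and its local coordinates \<open>x k i\<close>; the definitions below only use
  \<open>x k i\<close> for \<open>(k, i) \<in> E\<close>.
\<close>

definition adjacency :: "('n \<times> 'm) set \<Rightarrow> (('n + 'm) \<times> ('n + 'm)) set" where
  "adjacency E = {(Inl k, Inr i) | k i. (k, i) \<in> E} \<union> {(Inr i, Inl k) | k i. (k, i) \<in> E}"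

definition graph_connected :: "('n \<times> 'm) set \<Rightarrow> bool" where
  "graph_connected E \<longleftrightarrow> (\<forall>u v. (u, v) \<in> (adjacency E)\<^sup>*)"

definition affinely_nondegenerate ::
  "('n::finite \<times> 'm) set \<Rightarrow> ('n \<Rightarrow> 'm \<Rightarrow> real^'d::finite) \<Rightarrow> 'm \<Rightarrow> bool" where
  "affinely_nondegenerate E x i \<longleftrightarrow>
     card {k. (k, i) \<in> E} \<ge> CARD('d) + 1 \<and>
     aff_dim (affine hull {x k i | k. (k, i) \<in> E}) = int CARD('d)"

definition is_pseudoinverse :: "real^'q^'p \<Rightarrow> real^'p^'q \<Rightarrow> bool" where
  "is_pseudoinverse A X \<longleftrightarrow>
     A ** X ** A = A \<and> X ** A ** X = X \<and>
     transpose (A ** X) = A ** X \<and> transpose (X ** A) = X ** A"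

text \<open>The four Penrose equations have exactly one solution for every real matrix.\<close>

definition pseudoinverse :: "real^'q^'p \<Rightarrow> real^'p^'q" where
  "pseudoinverse A = (THE X. is_pseudoinverse A X)"

text \<open>
  The matrix \<open>u v\<^sup>T\<close>. The type annotations matter: \<open>columnvector\<close> and \<open>rowvector\<close> leave the
  number of columns, respectively rows, open.
\<close>

definition outer :: "real^'p \<Rightarrow> real^'q \<Rightarrow> real^'q^'p" where
  "outer u v = (columnvector u :: real^1^'p) ** (rowvector v :: real^'q^1)"

definition edge_vec :: "'n::finite \<Rightarrow> 'm::finite \<Rightarrow> real^('n + 'm)" where
  "edge_vec k i = axis (Inl k) 1 - axis (Inr i) 1"

text \<open>The Kronecker product of the \<open>i\<close>-th standard basis vector of \<open>\<real>\<^sup>m\<close> with the identity matrix.\<close>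

definition block_embed :: "'m::finite \<Rightarrow> real^'d^('m \<times> 'd::finite)" where
  "block_embed i = (\<chi> p b. (axis i 1 :: real^'m) $ fst p * (mat 1 :: real^'d^'d) $ snd p $ b)"

definition laplacian :: "('n::finite \<times> 'm::finite) set \<Rightarrow> real^('n + 'm)^('n + 'm)" where
  "laplacian E = (\<Sum>(k, i)\<in>E. outer (edge_vec k i) (edge_vec k i))"

definition matB ::
  "('n::finite \<times> 'm::finite) set \<Rightarrow> ('n \<Rightarrow> 'm \<Rightarrow> real^'d::finite) \<Rightarrow> real^('n + 'm)^('m \<times> 'd)" where
  "matB E x =
     (\<Sum>(k, i)\<in>E. block_embed i ** outer (x k i) (edge_vec k i))"

definition matD ::
  "('n::finite \<times> 'm::finite) set \<Rightarrow> ('n \<Rightarrow> 'm \<Rightarrow> real^'d::finite) \<Rightarrow> real^('m \<times> 'd)^('m \<times> 'd)" where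
  "matD E x =
     (\<Sum>(k, i)\<in>E. block_embed i ** outer (x k i) (x k i) ** transpose (block_embed i))"

definition matC ::
  "('n::finite \<times> 'm::finite) set \<Rightarrow> ('n \<Rightarrow> 'm \<Rightarrow> real^'d::finite) \<Rightarrow> real^('m \<times> 'd)^('m \<times> 'd)" where
  "matC E x = matD E x - matB E x ** pseudoinverse (laplacian E) ** transpose (matB E x)"

definition alignment :: "real^'d^('m::finite \<times> 'd::finite) \<Rightarrow> bool" where
  "alignment S \<longleftrightarrow> (\<forall>i. orthogonal_matrix (\<chi> a b. S $ (i, a) $ b))"

definition objective ::
  "('n::finite \<times> 'm::finite) set \<Rightarrow> ('n \<Rightarrow> 'm \<Rightarrow> real^'d::finite) \<Rightarrow> real^'d^('m \<times> 'd) \<Rightarrow> real" where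
  "objective E x S = trace (matC E x ** S ** transpose S)"

definition perfect_alignment ::
  "('n::finite \<times> 'm::finite) set \<Rightarrow> ('n \<Rightarrow> 'm \<Rightarrow> real^'d::finite) \<Rightarrow> real^'d^('m \<times> 'd) \<Rightarrow> bool" where
  "perfect_alignment E x S \<longleftrightarrow> alignment S \<and> objective E x S = 0"

definition optimal_alignment ::
  "('n::finite \<times> 'm::finite) set \<Rightarrow> ('n \<Rightarrow> 'm \<Rightarrow> real^'d::finite) \<Rightarrow> real^'d^('m \<times> 'd) \<Rightarrow> bool" where
  "optimal_alignment E x S \<longleftrightarrow>
     alignment S \<and> (\<forall>T. alignment T \<longrightarrow> objective E x S \<le> objective E x T)"

definition unique_alignment ::
  "('n::finite \<times> 'm::finite) set \<Rightarrow> ('n \<Rightarrow> 'm \<Rightarrow> real^'d::finite) \<Rightarrow> real^'d^('m \<times> 'd) \<Rightarrow> bool" where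
  "unique_alignment E x S \<longleftrightarrow>
     optimal_alignment E x S \<and>
     (\<forall>T. optimal_alignment E x T \<and> T \<noteq> S \<longrightarrow>
        (\<exists>Q :: real^'d^'d. orthogonal_matrix Q \<and> T = S ** Q))"

definition realization ::
  "('n::finite \<times> 'm::finite) set \<Rightarrow> ('n \<Rightarrow> 'm \<Rightarrow> real^'d::finite) \<Rightarrow> real^'d^('m \<times> 'd) \<Rightarrow> real^'n^'d" where
  "realization E x S =
     transpose S ** matB E x ** (\<chi> v k. pseudoinverse (laplacian E) $ v $ Inl k) **
     (mat 1 - (1 / real CARD('n)) *\<^sub>R outer 1 1)"

definition globally_rigid ::
  "('n::finite \<times> 'm::finite) set \<Rightarrow> ('n \<Rightarrow> 'm \<Rightarrow> real^'d::finite) \<Rightarrow> real^'d^('m \<times> 'd) \<Rightarrow> bool" where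
  "globally_rigid E x S \<longleftrightarrow>
     perfect_alignment E x S \<and>
     (\<forall>T. perfect_alignment E x T \<longrightarrow>
        (\<exists>Q :: real^'d^'d. orthogonal_matrix Q \<and> realization E x T = realization E x (S ** Q)))"

end

theory Submission imports Defs begin

text \<open>
  Put \<open>b\<^sub>k\<^sub>i = (\<epsilon>\<^sub>i \<otimes> I) x\<^sub>k\<^sub>,\<^sub>i\<close>, \<open>P\<close> the pseudoinverse of the Laplacian, and \<open>w\<^sub>k\<^sub>i = b\<^sub>k\<^sub>i - B P e\<^sub>k\<^sub>i\<close>.
  The Penrose equations give \<open>C = \<Sum> w\<^sub>k\<^sub>i w\<^sub>k\<^sub>i\<^sup>T\<close>, so the objective is the sum of the
  \<open>\<bar>S\<^sup>T w\<^sub>k\<^sub>i\<bar>\<^sup>2\<close>: it is nonnegative, and \<open>S\<close> is perfect iff \<open>S\<^sup>T b\<^sub>k\<^sub>i = S\<^sup>T B P e\<^sub>k\<^sub>i\<close> on every edge.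
  If \<open>S\<close> and \<open>T\<close> are perfect with equal realizations, the difference of these equations says that
  the linear map \<open>(T\<^sub>i - S\<^sub>i)\<^sup>T\<close> is constant on the points of view \<open>i\<close>; these affinely
  span the whole space, so \<open>T\<^sub>i = S\<^sub>i\<close>. The converse is immediate, as optimal and perfect
  alignments coincide.
\<close>

section \<open>Algebra of outer products, finite matrix sums and traces\<close>

lemma outer_nth: "outer u v $ i $ j = u $ i * v $ j"
  by (simp add: outer_def matrix_matrix_mult_def columnvector_def rowvector_def)

lemma outer_diff_left: "outer (u - u') v = outer u v - outer u' v"
  by (simp add: vec_eq_iff outer_nth algebra_simps)

lemma outer_diff_right: "outer u (v - v') = outer u v - outer u v'"
  by (simp add: vec_eq_iff outer_nth algebra_simps)

lemma outer_mult_left: "outer (A *v u) v = A ** outer u v"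
  by (simp add: vec_eq_iff outer_nth matrix_matrix_mult_def matrix_vector_mult_def
      sum_distrib_right mult.assoc)

lemma outer_mult_right: "outer u (A *v v) = outer u v ** transpose A"
  by (simp add: vec_eq_iff outer_nth matrix_matrix_mult_def matrix_vector_mult_def transpose_def
      sum_distrib_left mult_ac)

lemma outer_mult_vec: "outer u v *v y = (v \<bullet> y) *\<^sub>R u"
  by (simp add: vec_eq_iff outer_nth matrix_vector_mult_def inner_vec_def sum_distrib_left mult_ac)

lemma transpose_outer: "transpose (outer u v) = outer v u"
  by (simp add: vec_eq_iff outer_nth transpose_def)

lemma matrix_diff_ldistrib: "A ** (B - C) = A ** B - A ** (C :: real^'r^'q)"
  by (simp add: vec_eq_iff matrix_matrix_mult_def right_diff_distrib sum_subtractf)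

lemma matrix_diff_rdistrib: "(A - B) ** C = A ** C - B ** (C :: real^'r^'q)"
  by (simp add: vec_eq_iff matrix_matrix_mult_def left_diff_distrib sum_subtractf)

lemma matrix_add_rdistrib: "(A + B) ** C = A ** C + B ** (C :: real^'r^'q)"
  by (simp add: vec_eq_iff matrix_matrix_mult_def distrib_right sum.distrib)

lemma matrix_sum_ldistrib: "A ** sum f I = (\<Sum>i\<in>I. A ** (f i :: real^'r^'q))"
  by (induction I rule: infinite_finite_induct)
     (simp_all add: matrix_add_ldistrib)

lemma matrix_sum_rdistrib: "sum f I ** C = (\<Sum>i\<in>I. f i ** (C :: real^'r^'q))"
  by (induction I rule: infinite_finite_induct)
     (simp_all add: matrix_add_rdistrib)

lemma transpose_sum: "transpose (sum f I) = (\<Sum>i\<in>I. transpose (f i :: real^'r^'q))"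
  by (simp add: vec_eq_iff transpose_def)

lemma transpose_diff: "transpose (A - B) = transpose A - transpose (B :: real^'r^'q)"
  by (simp add: vec_eq_iff transpose_def)

lemma sum_matrix_vector_mult: "sum f I *v y = (\<Sum>i\<in>I. (f i :: real^'r^'q) *v y)"
  by (induction I rule: infinite_finite_induct)
     (simp_all add: matrix_vector_mult_add_rdistrib)

lemma trace_sum: "trace (sum f I) = (\<Sum>i\<in>I. trace (f i :: real^'q^'q))"
  by (simp add: trace_def sum.swap[of _ UNIV])

text \<open>Cyclicity of the trace moves \<open>transpose S\<close> to the front, which leaves the
  outer square of \<open>transpose S *v w\<close>.\<close>

lemma trace_outer_self_mult:
  "trace (outer w w ** S ** transpose S) = (norm (transpose S *v w))\<^sup>2"
proof -
  have "trace (outer w w ** S ** transpose S) = trace (outer (transpose S *v w) (transpose S *v w))"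
    by (simp add: outer_mult_left outer_mult_right matrix_mul_assoc trace_mul_sym[of _ "transpose S"]
        del: transpose_matrix_vector)
  also have "\<dots> = (norm (transpose S *v w))\<^sup>2"
    by (simp add: trace_def outer_nth power2_norm_eq_inner inner_vec_def)
  finally show ?thesis .
qed

section \<open>Uniqueness and existence of the pseudoinverse\<close>

lemma is_pseudoinverse_unique:
  assumes X: "is_pseudoinverse A X" and Y: "is_pseudoinverse A Y"
  shows "X = Y"
proof -
  \<comment> \<open>Both \<open>A ** X\<close> and \<open>A ** Y\<close> are the orthogonal
    projection onto the range of \<open>A\<close>; the symmetry equations make this
    algebraic.\<close>
  have "A ** X = transpose (A ** Y) ** transpose (A ** X)"
    using X Y by (simp add: is_pseudoinverse_def matrix_mul_assoc)
  also have "\<dots> = transpose (A ** X ** A ** Y)"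
    by (simp add: matrix_transpose_mul matrix_mul_assoc)
  also have "\<dots> = A ** Y"
    using X Y by (simp add: is_pseudoinverse_def)
  finally have AX: "A ** X = A ** Y" .
  have "X ** A = X ** (A ** Y ** A)"
    using Y by (simp add: is_pseudoinverse_def)
  also have "\<dots> = (X ** A) ** (Y ** A)"
    by (simp only: matrix_mul_assoc)
  also have "\<dots> = transpose (X ** A) ** transpose (Y ** A)"
    using X Y by (simp add: is_pseudoinverse_def)
  also have "\<dots> = transpose (Y ** (A ** X ** A))"
    by (simp add: matrix_transpose_mul matrix_mul_assoc)
  also have "\<dots> = Y ** A"
    using X Y by (simp add: is_pseudoinverse_def)
  finally have XA: "X ** A = Y ** A" .
  \<comment> \<open>Now X = XAX = XAY = YAY.\<close>
  have "X = X ** A ** X" "Y = Y ** A ** Y"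
    using X Y by (simp_all add: is_pseudoinverse_def)
  then show ?thesis
    using AX XA by (metis matrix_mul_assoc)
qed

lemma pseudoinverse_eq: "is_pseudoinverse A X \<Longrightarrow> pseudoinverse A = X"
  unfolding pseudoinverse_def by (blast intro: is_pseudoinverse_unique)

lemma is_pseudoinverse_transpose:
  assumes "is_pseudoinverse A X"
  shows "is_pseudoinverse (transpose A) (transpose X)"
proof -
  have "transpose (A ** X ** A) = transpose A" "transpose (X ** A ** X) = transpose X"
    "transpose (A ** X) = A ** X" "transpose (X ** A) = X ** A"
    using assms by (simp_all add: is_pseudoinverse_def)
  then show ?thesis
    by (simp add: is_pseudoinverse_def matrix_transpose_mul matrix_mul_assoc)
qed

text \<open>If \<open>K\<close> is the orthogonal projection onto the kernel of \<open>A\<close>, then \<open>(A + K)\<^sup>-\<^sup>1 - K\<close>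
  is the pseudoinverse of \<open>A\<close>.\<close>

lemma is_pseudoinverse_kernel_projection:
  fixes A K :: "real^'p^'p"
  assumes sym: "transpose K = K" and idem: "K ** K = K"
    and AK: "A ** K = 0" and KA: "K ** A = 0"
    and ker: "\<And>y. A *v y = 0 \<Longrightarrow> K *v y = y"
  shows "\<exists>X. is_pseudoinverse A X"
proof -
  have "(A + K) *v y = 0 \<Longrightarrow> y = 0" for y
  proof -
    assume y: "(A + K) *v y = 0"
    then have "(K ** (A + K)) *v y = 0"
      by (simp flip: matrix_vector_mul_assoc)
    then have K: "K *v y = 0"
      by (simp add: matrix_add_ldistrib KA idem)
    with y have "A *v y = 0"
      by (simp add: matrix_vector_mult_add_rdistrib)
    with K ker show "y = 0" by metis
  qed
  then obtain R where RM: "R ** (A + K) = mat 1"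
    by (metis matrix_left_invertible_ker)
  then have MR: "(A + K) ** R = mat 1"
    by (simp add: matrix_left_right_inverse)
  \<comment> \<open>Since \<open>(A + K) ** K = K\<close>, the inverse \<open>R\<close> also fixes
    \<open>K\<close>.\<close>
  have RK: "R ** K = K"
    using RM by (metis AK add_0 idem matrix_add_rdistrib matrix_mul_assoc matrix_mul_lid)
  have KR: "K ** R = K"
    using MR by (metis KA add_0 idem matrix_add_ldistrib matrix_mul_assoc matrix_mul_rid)
  have AR: "A ** R = mat 1 - K"
    using MR by (simp add: matrix_add_rdistrib KR eq_diff_eq)
  have RA: "R ** A = mat 1 - K"
    using RM by (simp add: matrix_add_ldistrib RK eq_diff_eq)
  have "A ** (R - K) = mat 1 - K" "(R - K) ** A = mat 1 - K"
    by (simp_all add: matrix_diff_ldistrib matrix_diff_rdistrib AR RA AK KA)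
  then have "is_pseudoinverse A (R - K)"
    by (simp add: is_pseudoinverse_def matrix_diff_ldistrib matrix_diff_rdistrib transpose_diff
        sym idem KA KR)
  then show ?thesis ..
qed

section \<open>The Laplacian of a connected graph and its pseudoinverse\<close>

lemma inner_edge_vec: "edge_vec k i \<bullet> y = y $ Inl k - y $ Inr i"
  by (simp add: edge_vec_def inner_diff_left inner_axis')

lemma transpose_laplacian: "transpose (laplacian E) = laplacian E"
  by (simp add: laplacian_def transpose_sum transpose_outer case_prod_unfold)

lemma laplacian_mult_vec:
  "laplacian E *v y = (\<Sum>(k, i)\<in>E. (y $ Inl k - y $ Inr i) *\<^sub>R edge_vec k i)"
  by (simp add: laplacian_def sum_matrix_vector_mult outer_mult_vec inner_edge_vec case_prod_unfold)

text \<open>The quadratic form of the Laplacian is the sum of squared differences along edges. If it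
  vanishes, \<open>y\<close> agrees across each edge, hence along each path.\<close>

lemma laplacian_kernel_constant:
  fixes E :: "('n::finite \<times> 'm::finite) set"
  assumes "graph_connected E" and y: "laplacian E *v y = 0"
  shows "y $ u = y $ v"
proof -
  have "(\<Sum>(k, i)\<in>E. (y $ Inl k - y $ Inr i)\<^sup>2) = (laplacian E *v y) \<bullet> y"
    by (simp add: laplacian_mult_vec inner_sum_left inner_edge_vec case_prod_unfold power2_eq_square)
  also have "\<dots> = 0" by (simp add: y)
  finally have "\<forall>e\<in>E. (y $ Inl (fst e) - y $ Inr (snd e))\<^sup>2 = 0"
    by (subst (asm) sum_nonneg_eq_0_iff) (auto simp: case_prod_unfold)
  then have step: "y $ a = y $ b" if "(a, b) \<in> adjacency E" for a b
    using that by (force simp: adjacency_def)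
  have "(u, v) \<in> (adjacency E)\<^sup>*"
    using assms(1) by (simp add: graph_connected_def)
  then show ?thesis
    by induction (simp_all add: step)
qed

lemma is_pseudoinverse_laplacian:
  fixes E :: "('n::finite \<times> 'm::finite) set"
  assumes "graph_connected E"
  shows "is_pseudoinverse (laplacian E) (pseudoinverse (laplacian E))"
proof -
  let ?L = "laplacian E"
  \<comment> \<open>\<open>K\<close> averages the entries: it is the orthogonal projection onto the
    constant vectors, which form the kernel of the Laplacian.\<close>
  define K :: "real^('n + 'm)^('n + 'm)" where "K = (\<chi> u v. 1 / real CARD('n + 'm))"
  have Kv: "(K *v y) $ u = (\<Sum>v\<in>UNIV. y $ v) / real CARD('n + 'm)" for y u
    by (simp add: K_def matrix_vector_mult_def sum_divide_distrib)
  have sym: "transpose K = K"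
    by (simp add: K_def transpose_def vec_eq_iff)
  have idem: "K ** K = K"
    by (simp add: K_def matrix_matrix_mult_def vec_eq_iff)
  have "?L *v (K *v y) = 0" for y
    by (simp add: laplacian_mult_vec Kv)
  then have LK: "?L ** K = 0"
    by (simp add: matrix_eq flip: matrix_vector_mul_assoc)
  have "K ** ?L = transpose (?L ** K)"
    by (simp add: matrix_transpose_mul sym transpose_laplacian)
  then have KL: "K ** ?L = 0"
    by (simp add: LK) (simp add: transpose_def vec_eq_iff)
  have "K *v y = y" if "?L *v y = 0" for y
  proof -
    have "(K *v y) $ u = y $ u" for u
    proof -
      have "(\<Sum>v\<in>UNIV. y $ v) = (\<Sum>v\<in>(UNIV :: ('n + 'm) set). y $ u)"
        by (intro sum.cong refl laplacian_kernel_constant[OF assms that])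
      moreover have "0 < real CARD('n) + real CARD('m)"
        by (simp add: add_pos_pos)
      ultimately show ?thesis by (simp add: Kv)
    qed
    then show ?thesis by (simp add: vec_eq_iff)
  qed
  then show ?thesis
    using is_pseudoinverse_kernel_projection[OF sym idem LK KL] pseudoinverse_eq by metis
qed

lemma transpose_pseudoinverse_laplacian:
  assumes "graph_connected E"
  shows "transpose (pseudoinverse (laplacian E)) = pseudoinverse (laplacian E)"
  using is_pseudoinverse_transpose[OF is_pseudoinverse_laplacian[OF assms]]
    pseudoinverse_eq transpose_laplacian by metis

section \<open>The objective as a sum of squared residuals\<close>

definition residual ::
  "('n::finite \<times> 'm::finite) set \<Rightarrow> ('n \<Rightarrow> 'm \<Rightarrow> real^'d::finite) \<Rightarrow> 'n \<Rightarrow> 'm \<Rightarrow> real^('m \<times> 'd)" where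
  "residual E x k i =
     block_embed i *v x k i - (matB E x ** pseudoinverse (laplacian E)) *v edge_vec k i"

text \<open>When the outer squares are expanded, symmetry of \<open>?P\<close> makes both cross
  terms B P B^T, and P L P = P makes the quadratic term B P B^T too. One copy survives with a minus
  sign.\<close>

lemma matC_eq_sum_residual:
  assumes "graph_connected E"
  shows "matC E x = (\<Sum>(k, i)\<in>E. outer (residual E x k i) (residual E x k i))"
proof -
  let ?P = "pseudoinverse (laplacian E)" and ?B = "matB E x" and ?L = "laplacian E"
  let ?M = "?B ** ?P"
  have B: "?B = (\<Sum>(k, i)\<in>E. outer (block_embed i *v x k i) (edge_vec k i))"
    by (simp add: matB_def outer_mult_left)
  have BT: "transpose ?B = (\<Sum>(k, i)\<in>E. outer (edge_vec k i) (block_embed i *v x k i))"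
    unfolding B by (simp add: transpose_sum transpose_outer case_prod_unfold)
  have D: "matD E x = (\<Sum>(k, i)\<in>E. outer (block_embed i *v x k i) (block_embed i *v x k i))"
    by (simp add: matD_def outer_mult_left outer_mult_right matrix_mul_assoc)
  have "(\<Sum>(k, i)\<in>E. outer (residual E x k i) (residual E x k i))
      = (\<Sum>(k, i)\<in>E. outer (block_embed i *v x k i) (block_embed i *v x k i))
        - ?M ** (\<Sum>(k, i)\<in>E. outer (edge_vec k i) (block_embed i *v x k i))
        - ((\<Sum>(k, i)\<in>E. outer (block_embed i *v x k i) (edge_vec k i)) ** transpose ?M
        - ?M ** (\<Sum>(k, i)\<in>E. outer (edge_vec k i) (edge_vec k i)) ** transpose ?M)"
    unfolding residual_def outer_diff_left outer_diff_right
    by (simp only: case_prod_unfold sum_subtractf matrix_sum_ldistrib matrix_sum_rdistrib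
        outer_mult_left[of ?M] outer_mult_right[of _ ?M] matrix_mul_assoc)
  also have "\<dots> = matD E x - ?M ** transpose ?B - (?B ** transpose ?M - ?M ** ?L ** transpose ?M)"
    by (simp add: D BT laplacian_def flip: B)
  also have "?B ** transpose ?M = ?M ** transpose ?B"
    by (simp add: matrix_transpose_mul transpose_pseudoinverse_laplacian[OF assms] matrix_mul_assoc)
  also have "?M ** ?L ** transpose ?M = ?B ** (?P ** ?L ** ?P) ** transpose ?B"
    by (simp add: matrix_transpose_mul transpose_pseudoinverse_laplacian[OF assms] matrix_mul_assoc)
  also have "?P ** ?L ** ?P = ?P"
    using is_pseudoinverse_laplacian[OF assms] by (simp add: is_pseudoinverse_def)
  finally show ?thesis
    by (simp add: matC_def)
qed

text \<open>The columns of \<open>transpose S ** matB E x ** pseudoinverse (laplacian E)\<close> are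
  least-squares vertex positions for \<open>S\<close>; each summand is the squared misfit left on
  one edge.\<close>

lemma objective_eq_sum_residual:
  assumes "graph_connected E"
  shows "objective E x S = (\<Sum>(k, i)\<in>E. (norm (transpose S *v residual E x k i))\<^sup>2)"
  by (simp add: objective_def matC_eq_sum_residual[OF assms] matrix_sum_rdistrib trace_sum
      case_prod_unfold trace_outer_self_mult)

lemma objective_nonneg: "graph_connected E \<Longrightarrow> 0 \<le> objective E x S"
  by (auto simp: objective_eq_sum_residual intro!: sum_nonneg)

lemma objective_eq_0_iff:
  assumes "graph_connected E"
  shows "objective E x S = 0 \<longleftrightarrow> (\<forall>(k, i)\<in>E. transpose S *v residual E x k i = 0)"
  unfolding objective_eq_sum_residual[OF assms]
  by (subst sum_nonneg_eq_0_iff) (auto simp: case_prod_unfold)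

text \<open>The perfect alignment \<open>S\<close> shows that the lower bound 0 of the objective is
  attained.\<close>

lemma optimal_iff_perfect:
  assumes "graph_connected E" and "perfect_alignment E x S"
  shows "optimal_alignment E x T \<longleftrightarrow> perfect_alignment E x T"
  using assms(2) objective_nonneg[OF assms(1), of x]
  unfolding optimal_alignment_def perfect_alignment_def by (metis order_antisym)

section \<open>Recovering a perfect alignment from its realization\<close>

lemma linear_constant_on_spanning_set_zero:
  fixes A :: "real^'p^'q"
  assumes "affine hull X = UNIV" and "\<And>y. y \<in> X \<Longrightarrow> A *v y = c"
  shows "A = 0"
proof -
  have "affine {y. A *v y = c}"
    by (auto simp: affine_def matrix_vector_right_distrib matrix_vector_mult_scaleR
        simp flip: scaleR_left_distrib)
  then have "affine hull X \<subseteq> {y. A *v y = c}"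
    using assms(2) by (intro hull_minimal) auto
  then have "A *v y = c" for y
    using assms(1) by auto
  \<comment> \<open>Evaluation at the origin gives c = 0.\<close>
  then have "A *v y = 0" for y
    using matrix_vector_mult_0_right[of A] by metis
  then show ?thesis
    by (simp add: matrix_eq)
qed

lemma affinely_nondegenerate_hull:
  "affinely_nondegenerate E x i \<Longrightarrow> affine hull {x k i | k. (k, i) \<in> E} = UNIV"
  by (simp add: affinely_nondegenerate_def flip: aff_dim_eq_full)

lemma transpose_mult_block_embed_nth:
  "(transpose S ** block_embed i) $ b $ a = S $ (i, a) $ b"
proof -
  have "transpose S $ b $ p * block_embed i $ p $ a = (if p = (i, a) then S $ (i, a) $ b else 0)" for p
    by (cases p) (auto simp: transpose_def block_embed_def axis_def mat_def)
  then show ?thesis by (simp add: matrix_matrix_mult_def)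
qed

text \<open>The centering matrix subtracts from each row its mean, so a row sent to 0 equals its
  mean everywhere.\<close>

lemma centered_eq_0_imp_columns_equal:
  fixes M :: "real^'n::finite^'d"
  assumes "M ** (mat 1 - (1 / real CARD('n)) *\<^sub>R outer 1 1) = 0"
  shows "M $ a $ k = M $ a $ l"
proof -
  have "M $ a $ k = (\<Sum>j\<in>UNIV. M $ a $ j) / real CARD('n)" for k
  proof -
    have "M = M ** ((1 / real CARD('n)) *\<^sub>R outer 1 1)"
      using assms by (simp add: matrix_diff_ldistrib)
    then have "M $ a $ k = (M ** ((1 / real CARD('n)) *\<^sub>R outer 1 1)) $ a $ k"
      by simp
    then show ?thesis
      by (simp add: matrix_matrix_mult_def outer_nth sum_divide_distrib)
  qed
  then show ?thesis by metis
qed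

lemma realization_eq_imp_eq:
  fixes E :: "('n::finite \<times> 'm::finite) set"
    and x :: "'n \<Rightarrow> 'm \<Rightarrow> real^'d::finite"
  assumes conn: "graph_connected E"
    and nondeg: "\<And>i. affinely_nondegenerate E x i"
    and S: "objective E x S = 0" and T: "objective E x T = 0"
    and eq: "realization E x T = realization E x S"
  shows "T = S"
proof -
  \<comment> \<open>The edge equations and the realization are linear in the alignment, so only the
    difference matters. \<open>Y\<close> is the resulting difference of vertex positions.\<close>
  define U where "U = T - S"
  define Y where "Y = transpose U ** (matB E x ** pseudoinverse (laplacian E))"
  have tU: "transpose U = transpose T - transpose S"
    by (simp add: U_def transpose_diff)
  have edge: "(transpose U ** block_embed i) *v x k i = Y *v edge_vec k i" if "(k, i) \<in> E" for k i
  proof -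
    have "transpose U *v residual E x k i = 0"
      using S T that by (fastforce simp: objective_eq_0_iff[OF conn] tU matrix_vector_mult_diff_rdistrib
          simp del: transpose_matrix_vector)
    then show ?thesis
      by (simp add: residual_def Y_def matrix_vector_mult_diff_distrib matrix_vector_mul_assoc
        del: transpose_matrix_vector)
  qed
  have Ye: "(Y *v edge_vec k i) $ a = Y $ a $ Inl k - Y $ a $ Inr i" for k i a
    using inner_edge_vec[of k i "Y $ a"]
    by (simp add: matrix_vector_mul_component inner_commute)
  have cols: "transpose U ** matB E x ** (\<chi> v k. pseudoinverse (laplacian E) $ v $ Inl k)
      = (\<chi> a k. Y $ a $ Inl k)"
    by (simp add: Y_def matrix_mul_assoc) (simp add: vec_eq_iff matrix_matrix_mult_def)
  have "(transpose U ** matB E x ** (\<chi> v k. pseudoinverse (laplacian E) $ v $ Inl k)) **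
      (mat 1 - (1 / real CARD('n)) *\<^sub>R outer 1 1) = 0"
    using eq by (simp add: realization_def tU matrix_diff_rdistrib)
  from centered_eq_0_imp_columns_equal[OF this]
  have Yconst: "Y $ a $ Inl k = Y $ a $ Inl l" for a k l
    by (simp add: cols)
  have "transpose U ** block_embed i = 0" for i
  proof (rule linear_constant_on_spanning_set_zero[OF affinely_nondegenerate_hull[OF nondeg]])
    fix y assume "y \<in> {x k i | k. (k, i) \<in> E}"
    then obtain k where "y = x k i" "(k, i) \<in> E" by auto
    \<comment> \<open>All point columns of \<open>Y\<close> coincide, so any fixed point, here
      \<open>undefined\<close>, names the common value for view \<open>i\<close>.\<close>
    moreover have "Y *v edge_vec k i = Y *v edge_vec undefined i"
      using Yconst by (simp add: vec_eq_iff Ye)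
    ultimately show "(transpose U ** block_embed i) *v y = Y *v edge_vec undefined i"
      using edge by metis
  qed
  then have "U $ (i, a) $ b = 0" for i a b
    by (simp flip: transpose_mult_block_embed_nth)
  then show ?thesis
    by (simp add: U_def vec_eq_iff)
qed

theorem theorem4p3:
  fixes E :: "('n::finite \<times> 'm::finite) set"
    and x :: "'n \<Rightarrow> 'm \<Rightarrow> real^'d::finite"
    and S :: "real^'d^('m \<times> 'd)"
  assumes "graph_connected E"
    and "\<And>i. affinely_nondegenerate E x i"
    and "perfect_alignment E x S"
  shows "globally_rigid E x S \<longleftrightarrow> unique_alignment E x S"
proof
  note opt = optimal_iff_perfect[OF assms(1,3)]
  assume rigid: "globally_rigid E x S"
  show "unique_alignment E x S"
    unfolding unique_alignment_def opt
  proof (intro conjI allI impI)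
    fix T assume T: "perfect_alignment E x T \<and> T \<noteq> S"
    then obtain Q :: "real^'d^'d" where Q: "orthogonal_matrix Q"
      and eq: "realization E x T = realization E x (S ** Q)"
      using rigid by (auto simp: globally_rigid_def)
    \<comment> \<open>A global factor \<open>Q\<close> only applies \<open>transpose Q\<close> to
      residual images that are already 0.\<close>
    have "objective E x (S ** Q) = 0"
      using assms(3)
      by (auto simp: perfect_alignment_def objective_eq_0_iff[OF assms(1)] matrix_transpose_mul
          simp flip: matrix_vector_mul_assoc)
    then have "T = S ** Q"
      using T eq assms(1,2) by (intro realization_eq_imp_eq) (auto simp: perfect_alignment_def)
    with Q show "\<exists>Q :: real^'d^'d. orthogonal_matrix Q \<and> T = S ** Q" by blast
  qed (rule assms(3))
next
  note opt = optimal_iff_perfect[OF assms(1,3)]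
  assume uniq: "unique_alignment E x S"
  show "globally_rigid E x S"
    unfolding globally_rigid_def
  proof (intro conjI allI impI)
    fix T assume "perfect_alignment E x T"
    \<comment> \<open>Uniqueness speaks only of \<open>T\<close> other than \<open>S\<close>; for
      \<open>T = S\<close> the witness is the identity.\<close>
    then have "\<exists>Q :: real^'d^'d. orthogonal_matrix Q \<and> T = S ** Q"
      using uniq orthogonal_matrix_id matrix_mul_rid unfolding unique_alignment_def opt by metis
    then show "\<exists>Q :: real^'d^'d. orthogonal_matrix Q \<and> realization E x T = realization E x (S ** Q)"
      by blast
  qed (rule assms(3))
qed

end
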